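(* Let $\mathcal{X}$ be a set of objects and let $\mathcal{K}:\mathcal{X}\times\mathcal{X}\to\mathbb{R}$ be a Mercer kernel, so that $\mathcal{K}(x,y)=\langle\varphi(x),\varphi(y)\rangle_{\mathcal{H}}$ for some feature map $\varphi$ into a Hilbert space $\mathcal{H}$, with induced metric $d_\mathcal{K}(x,y)=\|\varphi(x)-\varphi(y)\|_{\mathcal{H}}=\sqrt{\mathcal{K}(x,x)+\mathcal{K}(y,y)-2\mathcal{K}(x,y)}$. Let $S\subseteq\mathcal{X}$ be a finite set and let $T$ be a cover tree on $S$ with respect to $d_\mathcal{K}$. Let $(p,i)$ be a node of $T$ (object $p$ at level $i$) and let $S_p^i$ be the set of objects in the subtree rooted at this node. Then for every (query) object $q\in\mathcal{X}$, $$\max_{r\in S_p^i}\mathcal{K}(q,r)\;\le\;\mathcal{K}(q,p)+2^{i+1}\sqrt{\mathcal{K}(q,q)}.$$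
   Context: A cover tree on a finite set $S$ with respect to a metric $d$ is a leveled tree with levels $C_i\subseteq S$ indexed by integers $i$ (decreasing as the tree is descended), where $C_\infty$ consists of a single point (the root) and $C_{-\infty}=S$, satisfying for all $i$: (nesting) $C_i\subseteq C_{i-1}$; (covering) for every $p\in C_{i-1}$ there is $q\in C_i$ with $d(p,q)\le 2^i$, and exactly one such $q$ is the parent of $p$; (separation) for all distinct $p,q\in C_i$, $d(p,q)>2^i$. A node is a pair $(p,i)$ with $p\in C_i$; its children are the nodes $(r,i-1)$ whose parent is $p$ (including $(p,i-1)$ itself), and $S_p^i$ denotes the set of objects appearing in the subtree rooted at $(p,i)$. *)

theory Defs
  imports "HOL-Analysis.Inner_Product"
begin

text \<open>Hilbert spaces are the types of sort \<open>{real_inner, complete_space}\<close>.\<close>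

definition mercer_kernel ::
    "'x set \<Rightarrow> ('x \<Rightarrow> 'x \<Rightarrow> real) \<Rightarrow> ('x \<Rightarrow> 'h::{real_inner, complete_space}) \<Rightarrow> bool" where
  "mercer_kernel X K \<phi> \<longleftrightarrow> (\<forall>x\<in>X. \<forall>y\<in>X. K x y = inner (\<phi> x) (\<phi> y))"

definition kernel_dist :: "('x \<Rightarrow> 'h::{real_inner, complete_space}) \<Rightarrow> 'x \<Rightarrow> 'x \<Rightarrow> real" where
  "kernel_dist \<phi> x y = norm (\<phi> x - \<phi> y)"

lemma kernel_dist_eq_sqrt:
  assumes "mercer_kernel X K \<phi>" "x \<in> X" "y \<in> X"
  shows "kernel_dist \<phi> x y = sqrt (K x x + K y y - 2 * K x y)"
  using assms
  by (simp add: mercer_kernel_def kernel_dist_def norm_eq_sqrt_inner inner_diff_left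
      inner_diff_right inner_commute algebra_simps)

text \<open>A node is a pair \<open>(p, i)\<close> with \<open>p \<in> level T i\<close>. Levels decrease downwards, and
  \<open>parent T i p\<close> is the object \<open>q\<close> such that the node \<open>(p, i)\<close> hangs below \<open>(q, i + 1)\<close>;
  its value is irrelevant when \<open>p \<notin> level T i\<close>.\<close>

record 'a leveled_tree =
  level :: "int \<Rightarrow> 'a set"
  parent :: "int \<Rightarrow> 'a \<Rightarrow> 'a"

definition nodes :: "'a leveled_tree \<Rightarrow> ('a \<times> int) set" where
  "nodes T = {(p, i). p \<in> level T i}"

definition children :: "'a leveled_tree \<Rightarrow> 'a \<times> int \<Rightarrow> ('a \<times> int) set" where
  "children T = (\<lambda>(p, i). {(r, i - 1) | r. r \<in> level T (i - 1) \<and> parent T (i - 1) r = p})"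

text \<open>The levels at plus and minus infinity are the limits of the nested levels, that is, their
  intersection and their union. On a finite set both limits are attained at a finite level.\<close>

definition cover_tree :: "'a set \<Rightarrow> ('a \<Rightarrow> 'a \<Rightarrow> real) \<Rightarrow> 'a leveled_tree \<Rightarrow> bool" where
  "cover_tree S d T \<longleftrightarrow>
     (\<exists>root. (\<Inter>i. level T i) = {root}) \<and>
     (\<Union>i. level T i) = S \<and>
     (\<forall>i. level T i \<subseteq> level T (i - 1)) \<and>
     (\<forall>i. \<forall>p\<in>level T (i - 1).
        parent T (i - 1) p \<in> level T i \<and> d p (parent T (i - 1) p) \<le> 2 powi i) \<and>
     (\<forall>i. \<forall>p\<in>level T i. \<forall>q\<in>level T i. p \<noteq> q \<longrightarrow> d p q > 2 powi i)"

text \<open>By separation, a point of level \<open>i\<close> is its own parent at level \<open>i - 1\<close>.\<close>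

lemma cover_tree_self_child:
  assumes "cover_tree S d T" "(p, i) \<in> nodes T"
  shows "(p, i - 1) \<in> children T (p, i)"
proof -
  have p: "p \<in> level T i" "p \<in> level T (i - 1)"
    using assms unfolding cover_tree_def nodes_def by auto
  then have q: "parent T (i - 1) p \<in> level T i" "d p (parent T (i - 1) p) \<le> 2 powi i"
    using assms(1) unfolding cover_tree_def by auto
  have "\<not> d p (parent T (i - 1) p) > 2 powi i"
    using q(2) by simp
  then have "parent T (i - 1) p = p"
    using assms(1) p(1) q(1) unfolding cover_tree_def by metis
  with p show ?thesis by (simp add: children_def)
qed

definition subtree_objects :: "'a leveled_tree \<Rightarrow> 'a \<Rightarrow> int \<Rightarrow> 'a set" where
  "subtree_objects T p i = {r. \<exists>j. ((p, i), (r, j)) \<in> {(u, v). v \<in> children T u}\<^sup>*}"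

lemma root_in_subtree_objects: "p \<in> subtree_objects T p i"
  unfolding subtree_objects_def by blast

lemma subtree_objects_subset:
  assumes "cover_tree S d T" "(p, i) \<in> nodes T"
  shows "subtree_objects T p i \<subseteq> S"
proof -
  have "v \<in> nodes T" if "((p, i), v) \<in> {(u, v). v \<in> children T u}\<^sup>*" for v
    using that by induction (use assms(2) in \<open>auto simp: children_def nodes_def\<close>)
  then have "subtree_objects T p i \<subseteq> (\<Union>i. level T i)"
    unfolding subtree_objects_def nodes_def by blast
  then show ?thesis
    using assms(1) unfolding cover_tree_def by simp
qed

end

theory Submission imports Defs begin

text \<open>A path descending from level \<open>i\<close> to level \<open>j\<close> has length at most the geometric sum of
  \<open>2 powi k\<close> over \<open>j < k \<le> i\<close>, which is \<open>2 powi (i + 1) - 2 powi (j + 1)\<close>. So every object of the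
  subtree lies within \<open>2 powi (i + 1)\<close> of \<open>p\<close>, and Cauchy-Schwarz bounds \<open>K q r - K q p\<close>, the inner
  product of \<open>\<phi> q\<close> with \<open>\<phi> r - \<phi> p\<close>.\<close>

lemma descendant_dist_le:
  assumes tree: "cover_tree S d T"
    and refl: "d p p = 0"
    and triangle: "\<And>x y. x \<in> S \<Longrightarrow> y \<in> S \<Longrightarrow> d x p \<le> d x y + d y p"
    and p: "(p, i) \<in> nodes T"
    and path: "((p, i), v) \<in> {(u, v). v \<in> children T u}\<^sup>*"
  shows "v \<in> nodes T \<and> d (fst v) p \<le> 2 powi (i + 1) - 2 powi (snd v + 1)"
  using path
\<comment> \<open>The bound is 0 at the start. An edge down from level \<open>j\<close> adds at most
  \<open>2 powi j\<close>, which halves the subtracted \<open>2 powi (j + 1)\<close>.\<close>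
proof induction
  case base
  show ?case using p refl by simp
next
  case (step u v)
  obtain x j where u: "u = (x, j)" by (cases u)
  with step.hyps obtain r where v: "v = (r, j - 1)" "r \<in> level T (j - 1)"
    and x: "parent T (j - 1) r = x"
    by (auto simp: children_def)
  have dist_parent: "d r x \<le> 2 powi j"
    using tree v(2) x unfolding cover_tree_def by blast
  have "r \<in> S" "x \<in> S"
    using tree v(2) step.IH unfolding cover_tree_def nodes_def u by auto
  then have "d r p \<le> d r x + d x p" by (rule triangle)
  also have "\<dots> \<le> 2 powi j + (2 powi (i + 1) - 2 powi (j + 1))"
    using dist_parent step.IH u by simp
  also have "\<dots> = 2 powi (i + 1) - 2 powi j"
    by (simp add: power_int_add)
  finally show ?case using v by (simp add: nodes_def)
qed

text \<open>Dropping the subtracted positive term gives a bound uniform in the depth at which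
  \<open>r\<close> occurs.\<close>

lemma subtree_objects_dist_le:
  assumes "cover_tree S d T" "d p p = 0"
    and "\<And>x y. x \<in> S \<Longrightarrow> y \<in> S \<Longrightarrow> d x p \<le> d x y + d y p"
    and "(p, i) \<in> nodes T" "r \<in> subtree_objects T p i"
  shows "d r p \<le> 2 powi (i + 1)"
proof -
  obtain j where "((p, i), (r, j)) \<in> {(u, v). v \<in> children T u}\<^sup>*"
    using assms(5) unfolding subtree_objects_def by blast
  from descendant_dist_le[OF assms(1-4) this]
  have "d r p \<le> 2 powi (i + 1) - 2 powi (j + 1)" by simp
  also have "\<dots> \<le> 2 powi (i + 1)" by simp
  finally show ?thesis .
qed

text \<open>\<open>K q\<close> is linear in the feature vector, hence Lipschitz with constant the
  norm of \<open>\<phi> q\<close>.\<close>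

lemma kernel_le_kernel_dist:
  assumes K: "mercer_kernel X K \<phi>" and "q \<in> X" "r \<in> X" "p \<in> X"
  shows "K q r \<le> K q p + kernel_dist \<phi> r p * sqrt (K q q)"
proof -
  have "K q r - K q p = inner (\<phi> q) (\<phi> r - \<phi> p)"
    using assms by (simp add: mercer_kernel_def inner_diff_right)
  also have "\<dots> \<le> norm (\<phi> q) * norm (\<phi> r - \<phi> p)"
    by (rule norm_cauchy_schwarz)
  also have "norm (\<phi> q) = sqrt (K q q)"
    using assms by (simp add: mercer_kernel_def norm_eq_sqrt_inner)
  finally show ?thesis by (simp add: kernel_dist_def mult.commute)
qed

theorem theorem4p1:
  fixes X S :: "'x set"
    and K :: "'x \<Rightarrow> 'x \<Rightarrow> real"
    and \<phi> :: "'x \<Rightarrow> 'h::{real_inner, complete_space}"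
    and T :: "'x leveled_tree"
    and p q :: 'x and i :: int
  assumes "mercer_kernel X K \<phi>"
    and "finite S" and "S \<subseteq> X"
    and "cover_tree S (kernel_dist \<phi>) T"
    and "(p, i) \<in> nodes T"
    and "q \<in> X"
  shows "(MAX r\<in>subtree_objects T p i. K q r) \<le> K q p + 2 powi (i + 1) * sqrt (K q q)"
proof -
  have sub: "subtree_objects T p i \<subseteq> S"
    using assms(4,5) by (rule subtree_objects_subset)
  have "K q r \<le> K q p + 2 powi (i + 1) * sqrt (K q q)" if r: "r \<in> subtree_objects T p i" for r
  proof -
    have "p \<in> X" "r \<in> X"
      using sub assms(3) r root_in_subtree_objects[of p T i] by auto
    then have "K q r \<le> K q p + kernel_dist \<phi> r p * sqrt (K q q)"
      using assms(1,6) by (intro kernel_le_kernel_dist)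
    \<comment> \<open>The two open premises, zero self-distance and the triangle inequality, are
      inherited from the norm through \<open>\<phi>\<close>.\<close>
    moreover have "kernel_dist \<phi> r p \<le> 2 powi (i + 1)"
      using assms(4) _ _ assms(5) r
      by (rule subtree_objects_dist_le) (simp_all add: kernel_dist_def dist_triangle flip: dist_norm)
    moreover have "0 \<le> sqrt (K q q)"
      using assms(1,6) by (simp add: mercer_kernel_def)
    ultimately show ?thesis by (smt (verit) mult_right_mono)
  qed
  \<comment> \<open>\<open>Max\<close> is characterised by its elements only on finite nonempty
    sets; \<open>p\<close> itself is a member.\<close>
  moreover have "finite (subtree_objects T p i)" "subtree_objects T p i \<noteq> {}"
    using sub assms(2) finite_subset root_in_subtree_objects[of p T i] by auto
  ultimately show ?thesis by simp
qed

end
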